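(* Let $\mu,\mu'$ be Borel probability measures on $\mathbb{R}^d$. Assume that the convolution $\mu*\mu'$ has a Bessel measure $\nu$. Then $|\widehat{\mu'}|^2\,d\nu$ is a Bessel measure for $\mu$ with the same bound. If in addition $\nu$ is a frame measure for $\mu*\mu'$ with bounds $A$ and $B$, and $c>0$ is a constant such that $c\|f\|_{L^2(\mu)}^2\le \|Pf\|_{L^2(\mu*\mu')}^2$ for all $f\in L^2(\mu)$, then $|\widehat{\mu'}|^2\,d\nu$ is a frame measure for $\mu$ with bounds $cA$ and $B$.
   Context: For a finite Borel measure $\rho$ on $\mathbb{R}^d$ and $f\in L^1(\rho)$, put $\widehat{f\,d\rho}(t)=\int f(x)e^{-2\pi i t\cdot x}\,d\rho(x)$ and $\widehat{\rho}(t)=\int e^{-2\pi i t\cdot x}\,d\rho(x)$, $t\in\mathbb{R}^d$. A (nonnegative) Borel measure $\nu$ on $\mathbb{R}^d$ is a Bessel measure for $\rho$ with bound $B>0$ if $\|\widehat{f\,d\rho}\|_{L^2(\nu)}^2\le B\|f\|_{L^2(\rho)}^2$ for every $f\in L^2(\rho)$; it is a frame measure for $\rho$ with bounds $A,B>0$ if $A\|f\|_{L^2(\rho)}^2\le \|\widehat{f\,d\rho}\|_{L^2(\nu)}^2\le B\|f\|_{L^2(\rho)}^2$ for every $f\in L^2(\rho)$. For $f\in L^1(\mu)$, the (complex) measure $(f\,d\mu)*\mu'$ is absolutely continuous with respect to $\mu*\mu'$, and $Pf=P_{\mu,\mu'}f$ denotes its Radon-Nikodym derivative $Pf=\frac{d((f\,d\mu)*\mu')}{d(\mu*\mu')}$.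 *)

theory Defs
  imports "HOL-Probability.Probability"
begin

text \<open>
  Norms of possibly non-square-integrable functions are needed (a measure \<open>\<nu>\<close> may be infinite),
  so squared norms take values in \<^typ>\<open>ennreal\<close>; elements of $L^2$ are represented by functions.
\<close>

definition L2_space :: "'a measure \<Rightarrow> ('a \<Rightarrow> complex) set" where
  "L2_space M = {f \<in> borel_measurable M. integrable M (\<lambda>x. (cmod (f x))\<^sup>2)}"

definition L2_norm_sq :: "'a measure \<Rightarrow> ('a \<Rightarrow> complex) \<Rightarrow> ennreal" where
  "L2_norm_sq M f = (\<integral>\<^sup>+ x. ennreal ((cmod (f x))\<^sup>2) \<partial>M)"

definition fourier_fun_measure ::
    "(real ^ 'd) measure \<Rightarrow> (real ^ 'd \<Rightarrow> complex) \<Rightarrow> real ^ 'd \<Rightarrow> complex" where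
  "fourier_fun_measure \<rho> f t =
     (\<integral>x. f x * exp (- 2 * of_real pi * \<i> * of_real (t \<bullet> x)) \<partial>\<rho>)"

definition fourier_measure :: "(real ^ 'd) measure \<Rightarrow> real ^ 'd \<Rightarrow> complex" where
  "fourier_measure \<rho> t = (\<integral>x. exp (- 2 * of_real pi * \<i> * of_real (t \<bullet> x)) \<partial>\<rho>)"

text \<open>
  In the next two definitions \<open>\<rho>\<close> is meant to be a finite Borel measure. The measure \<open>\<nu>\<close> is an
  arbitrary Borel measure, with no finiteness assumption.
\<close>

definition bessel_measure :: "(real ^ 'd) measure \<Rightarrow> (real ^ 'd) measure \<Rightarrow> real \<Rightarrow> bool" where
  "bessel_measure \<rho> \<nu> B \<longleftrightarrow>
     sets \<nu> = sets borel \<and> 0 < B \<and>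
     (\<forall>f \<in> L2_space \<rho>.
        L2_norm_sq \<nu> (fourier_fun_measure \<rho> f) \<le> ennreal B * L2_norm_sq \<rho> f)"

definition frame_measure ::
    "(real ^ 'd) measure \<Rightarrow> (real ^ 'd) measure \<Rightarrow> real \<Rightarrow> real \<Rightarrow> bool" where
  "frame_measure \<rho> \<nu> A B \<longleftrightarrow>
     sets \<nu> = sets borel \<and> 0 < A \<and> 0 < B \<and>
     (\<forall>f \<in> L2_space \<rho>.
        ennreal A * L2_norm_sq \<rho> f \<le> L2_norm_sq \<nu> (fourier_fun_measure \<rho> f) \<and>
        L2_norm_sq \<nu> (fourier_fun_measure \<rho> f) \<le> ennreal B * L2_norm_sq \<rho> f)"

text \<open>Complex measures are represented by their values on Borel sets.\<close>

definition complex_density :: "'a measure \<Rightarrow> ('a \<Rightarrow> complex) \<Rightarrow> 'a set \<Rightarrow> complex" where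
  "complex_density \<mu> f E = (LINT x:E|\<mu>. f x)"

definition complex_convolution ::
    "((real ^ 'd) set \<Rightarrow> complex) \<Rightarrow> (real ^ 'd) measure \<Rightarrow> (real ^ 'd) set \<Rightarrow> complex" where
  "complex_convolution \<kappa> \<mu>' E = (\<integral>y. \<kappa> {x. x + y \<in> E} \<partial>\<mu>')"

definition is_complex_RN_deriv ::
    "'a measure \<Rightarrow> ('a set \<Rightarrow> complex) \<Rightarrow> ('a \<Rightarrow> complex) \<Rightarrow> bool" where
  "is_complex_RN_deriv \<rho> \<kappa> g \<longleftrightarrow>
     integrable \<rho> g \<and> (\<forall>E \<in> sets \<rho>. \<kappa> E = (LINT x:E|\<rho>. g x))"

text \<open>
  The Radon-Nikodym derivative is unique only almost everywhere; an arbitrary version is chosen.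
\<close>

definition P_op :: "(real ^ 'd) measure \<Rightarrow> (real ^ 'd) measure \<Rightarrow>
    (real ^ 'd \<Rightarrow> complex) \<Rightarrow> real ^ 'd \<Rightarrow> complex" where
  "P_op \<mu> \<mu>' f =
     (SOME g. is_complex_RN_deriv (\<mu> \<star> \<mu>') (complex_convolution (complex_density \<mu> f) \<mu>') g)"

end

theory Submission
  imports Defs
begin

text \<open>
  Write \<open>\<rho> = \<mu> \<star> \<mu>'\<close>. Then \<open>\<rho>\<close> is the law of \<open>x + y\<close> under \<open>\<Omega> = \<mu> \<Otimes>\<^sub>M \<mu>'\<close>, and \<open>P f\<close> is the
  conditional expectation of \<open>f x\<close> given \<open>x + y\<close>, regarded as a function of the value of the sum:
  it is characterised by
    \<open>\<integral> (P f) h d\<rho> = \<integral> f x h (x + y) d\<Omega>\<close>  for all bounded Borel \<open>h\<close>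
  (\<open>pushforward_density\<close>, \<open>integral_P_op_mult\<close>). Two choices of \<open>h\<close> carry the proof.

  For \<open>h\<close> the character \<open>z \<mapsto> exp (- 2 \<pi> i t \<bullet> z)\<close>, multiplicativity of \<open>h\<close> and Fubini show that the
  transform of \<open>(P f) d\<rho>\<close> is the transform of \<open>f d\<mu>\<close> times that of \<open>\<mu>'\<close> (\<open>fourier_P_op\<close>). Hence the
  squared norm of the transform of \<open>f d\<mu>\<close> in $L^2$ of the weighted measure is the squared norm
  of the transform of \<open>(P f) d\<rho>\<close> in $L^2(\nu)$.

  For \<open>h\<close> the conjugate of \<open>P f\<close>, truncated to be bounded, the inequality \<open>2 Re (a b) \<le> |a|\<^sup>2 + |b|\<^sup>2\<close>
  shows that \<open>P\<close> is a contraction from $L^2(\mu)$ to $L^2(\rho)$ (\<open>L2_norm_sq_P_op_le\<close>).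

  Thus the inequalities that \<open>\<nu>\<close> satisfies for \<open>\<rho>\<close>, applied to \<open>P f\<close>, become inequalities for \<open>f\<close>: the
  contraction turns the upper bound \<open>B\<close> into the same upper bound, and the hypothesis
  \<open>c \<parallel>f\<parallel>\<^sup>2 \<le> \<parallel>P f\<parallel>\<^sup>2\<close> turns the lower bound \<open>A\<close> into \<open>c A\<close>.
\<close>

section \<open>Integrability of products and of square-integrable functions\<close>

lemma L2_space_imp_integrable:
  assumes "finite_measure M" and "f \<in> L2_space M"
  shows "integrable M f"
proof (rule Bochner_Integration.integrable_bound[where f="\<lambda>x. 1 + (cmod (f x))\<^sup>2"])
  interpret finite_measure M by fact
  show "integrable M (\<lambda>x. 1 + (cmod (f x))\<^sup>2)" "f \<in> borel_measurable M"
    using assms(2) by (auto simp: L2_space_def)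
  show "AE x in M. norm (f x) \<le> norm (1 + (cmod (f x))\<^sup>2)"
  proof (rule AE_I2)
    fix x
    have "0 \<le> (cmod (f x) - 1)\<^sup>2" "0 \<le> (cmod (f x))\<^sup>2" by simp_all
    then show "norm (f x) \<le> norm (1 + (cmod (f x))\<^sup>2)"
      unfolding power2_diff using norm_ge_zero[of "f x"] by (simp del: norm_ge_zero)
  qed
qed

lemma integrable_mult_bounded:
  fixes f h :: "'a \<Rightarrow> complex"
  assumes "integrable M f" "h \<in> borel_measurable M" "\<And>x. cmod (h x) \<le> C"
  shows "integrable M (\<lambda>x. f x * h x)"
proof (rule Bochner_Integration.integrable_bound)
  show "integrable M (\<lambda>x. C * cmod (f x))" using assms(1) by simp
  show "(\<lambda>x. f x * h x) \<in> borel_measurable M" using assms(1,2) by simp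
  show "AE x in M. norm (f x * h x) \<le> norm (C * cmod (f x))"
  proof (rule AE_I2)
    fix x
    have "cmod (f x) * cmod (h x) \<le> cmod (f x) * C" "0 \<le> C"
      using assms(3)[of x] order_trans[OF norm_ge_zero assms(3)] by (auto intro: mult_left_mono)
    then show "norm (f x * h x) \<le> norm (C * cmod (f x))"
      by (simp add: norm_mult mult.commute)
  qed
qed

section \<open>Push-forward of a complex density\<close>

text \<open>
  The measure \<open>F d\<Omega>\<close> is finite, so its image under \<open>S\<close> is a finite measure. It is absolutely
  continuous with respect to the image of \<open>\<Omega>\<close>, and \<open>g\<close> is its Radon-Nikodym derivative. Since the two
  sides are then integrals of \<open>h\<close> against one and the same measure, this holds for every measurable
  \<open>h\<close>: where one side fails to be integrable, so does the other, and both integrals are 0.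
\<close>

lemma pushforward_density_nonneg:
  fixes F :: "'a \<Rightarrow> real"
  assumes "finite_measure \<Omega>" and S[measurable]: "S \<in> measurable \<Omega> N"
    and F: "integrable \<Omega> F" and F0: "\<And>\<omega>. 0 \<le> F \<omega>"
  obtains g :: "'b \<Rightarrow> real" where "integrable (distr \<Omega> N S) g"
    and "\<And>h :: 'b \<Rightarrow> complex. h \<in> borel_measurable N \<Longrightarrow>
      (\<integral>y. g y *\<^sub>R h y \<partial>distr \<Omega> N S) = (\<integral>\<omega>. F \<omega> *\<^sub>R h (S \<omega>) \<partial>\<Omega>)"
proof -
  have [measurable]: "F \<in> borel_measurable \<Omega>" using F by simp
  let ?\<rho> = "distr \<Omega> N S"
  define \<kappa> where "\<kappa> = distr (density \<Omega> F) N S"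
  interpret \<rho>: finite_measure ?\<rho>
    using assms(1) S by (rule finite_measure.finite_measure_distr)
  have F_fin: "(\<integral>\<^sup>+\<omega>. ennreal (F \<omega>) \<partial>\<Omega>) < \<infinity>"
    using F F0 by (simp add: integrable_iff_bounded)
  have \<kappa>_fin: "finite_measure \<kappa>"
    unfolding \<kappa>_def
  proof (rule finite_measure.finite_measure_distr)
    show "finite_measure (density \<Omega> F)"
      using F_fin by (intro finite_measureI) (simp add: emeasure_density nn_integral_cong[where u="\<lambda>x. ennreal (F x) * indicator (space \<Omega>) x" and v="\<lambda>x. ennreal (F x)"])
  qed simp
  have \<kappa>_ac: "absolutely_continuous ?\<rho> \<kappa>"
    unfolding absolutely_continuous_def
  proof
    fix E assume "E \<in> null_sets ?\<rho>"
    then have E: "E \<in> sets N" "S -` E \<inter> space \<Omega> \<in> null_sets \<Omega>"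
      by (auto simp: null_sets_distr_iff)
    then have "S -` E \<inter> space \<Omega> \<in> null_sets (density \<Omega> F)"
      by (subst null_sets_density_iff) (auto dest: AE_not_in)
    then show "E \<in> null_sets \<kappa>"
      using E by (simp add: \<kappa>_def null_sets_distr_iff)
  qed
  obtain g where g[measurable]: "g \<in> borel_measurable ?\<rho>"
    and RN: "AE y in ?\<rho>. RN_deriv ?\<rho> \<kappa> y = ennreal (g y)" and g0: "\<And>y. 0 \<le> g y"
    by (rule \<rho>.real_RN_deriv[OF \<kappa>_fin \<kappa>_ac]) (auto simp: \<kappa>_def)
  have "density ?\<rho> (RN_deriv ?\<rho> \<kappa>) = density ?\<rho> (\<lambda>y. ennreal (g y))"
    using RN by (intro density_cong) auto
  then have dens: "density ?\<rho> (\<lambda>y. ennreal (g y)) = \<kappa>"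
    using \<rho>.density_RN_deriv[OF \<kappa>_ac] by (simp add: \<kappa>_def)
  show thesis
  proof (rule that)
    have "(\<integral>\<^sup>+y. ennreal (g y) \<partial>?\<rho>) = emeasure (density ?\<rho> (\<lambda>y. ennreal (g y))) (space ?\<rho>)"
      by (simp add: emeasure_density cong: nn_integral_cong_simp)
    also have "\<dots> < \<infinity>"
      unfolding dens using finite_measure.emeasure_finite[OF \<kappa>_fin] by (simp add: less_top)
    finally show "integrable ?\<rho> g"
      using g0 by (intro integrableI_bounded) auto
  next
    fix h :: "'b \<Rightarrow> complex" assume [measurable]: "h \<in> borel_measurable N"
    have "(\<integral>y. g y *\<^sub>R h y \<partial>?\<rho>) = (\<integral>y. h y \<partial>density ?\<rho> (\<lambda>y. ennreal (g y)))"
      using g0 by (subst integral_density) auto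
    also have "\<dots> = (\<integral>\<omega>. F \<omega> *\<^sub>R h (S \<omega>) \<partial>\<Omega>)"
      using F0 unfolding dens \<kappa>_def by (simp add: integral_distr integral_density)
    finally show "(\<integral>y. g y *\<^sub>R h y \<partial>?\<rho>) = (\<integral>\<omega>. F \<omega> *\<^sub>R h (S \<omega>) \<partial>\<Omega>)" .
  qed
qed

text \<open>
  The positive and negative parts of \<open>Re F\<close> and \<open>Im F\<close> reduce this to nonnegative densities.
  Boundedness of \<open>h\<close> makes each product with \<open>h\<close> integrable, so that the integrals may be added.
\<close>

lemma pushforward_density:
  fixes F :: "'a \<Rightarrow> complex"
  assumes fin: "finite_measure \<Omega>" and S[measurable]: "S \<in> measurable \<Omega> N" and F: "integrable \<Omega> F"
  obtains g :: "'b \<Rightarrow> complex" where "integrable (distr \<Omega> N S) g"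
    and "\<And>h C. h \<in> borel_measurable N \<Longrightarrow> (\<And>y. cmod (h y) \<le> C) \<Longrightarrow>
      (\<integral>y. g y * h y \<partial>distr \<Omega> N S) = (\<integral>\<omega>. F \<omega> * h (S \<omega>) \<partial>\<Omega>)"
proof -
  let ?\<rho> = "distr \<Omega> N S"
  define F1 F2 F3 F4 where "F1 = (\<lambda>\<omega>. max 0 (Re (F \<omega>)))" and "F2 = (\<lambda>\<omega>. max 0 (- Re (F \<omega>)))"
    and "F3 = (\<lambda>\<omega>. max 0 (Im (F \<omega>)))" and "F4 = (\<lambda>\<omega>. max 0 (- Im (F \<omega>)))"
  have int: "integrable \<Omega> F1" "integrable \<Omega> F2" "integrable \<Omega> F3" "integrable \<Omega> F4"
    and pos: "\<And>\<omega>. 0 \<le> F1 \<omega>" "\<And>\<omega>. 0 \<le> F2 \<omega>" "\<And>\<omega>. 0 \<le> F3 \<omega>" "\<And>\<omega>. 0 \<le> F4 \<omega>"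
    using F by (auto simp: F1_def F2_def F3_def F4_def)
  have F_eq: "F \<omega> = (of_real (F1 \<omega>) - of_real (F2 \<omega>)) + \<i> * (of_real (F3 \<omega>) - of_real (F4 \<omega>))" for \<omega>
    by (simp add: F1_def F2_def F3_def F4_def complex_eq_iff max_def)
  note exI = pushforward_density_nonneg[OF fin S]
  obtain g1 where g1: "integrable ?\<rho> g1" "\<And>h::'b\<Rightarrow>complex. h \<in> borel_measurable N \<Longrightarrow>
      (\<integral>y. g1 y *\<^sub>R h y \<partial>?\<rho>) = (\<integral>\<omega>. F1 \<omega> *\<^sub>R h (S \<omega>) \<partial>\<Omega>)"
    using exI[OF int(1) pos(1)] by blast
  obtain g2 where g2: "integrable ?\<rho> g2" "\<And>h::'b\<Rightarrow>complex. h \<in> borel_measurable N \<Longrightarrow>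
      (\<integral>y. g2 y *\<^sub>R h y \<partial>?\<rho>) = (\<integral>\<omega>. F2 \<omega> *\<^sub>R h (S \<omega>) \<partial>\<Omega>)"
    using exI[OF int(2) pos(2)] by blast
  obtain g3 where g3: "integrable ?\<rho> g3" "\<And>h::'b\<Rightarrow>complex. h \<in> borel_measurable N \<Longrightarrow>
      (\<integral>y. g3 y *\<^sub>R h y \<partial>?\<rho>) = (\<integral>\<omega>. F3 \<omega> *\<^sub>R h (S \<omega>) \<partial>\<Omega>)"
    using exI[OF int(3) pos(3)] by blast
  obtain g4 where g4: "integrable ?\<rho> g4" "\<And>h::'b\<Rightarrow>complex. h \<in> borel_measurable N \<Longrightarrow>
      (\<integral>y. g4 y *\<^sub>R h y \<partial>?\<rho>) = (\<integral>\<omega>. F4 \<omega> *\<^sub>R h (S \<omega>) \<partial>\<Omega>)"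
    using exI[OF int(4) pos(4)] by blast
  define g where "g = (\<lambda>y. (complex_of_real (g1 y) - of_real (g2 y)) + \<i> * (of_real (g3 y) - of_real (g4 y)))"
  show thesis
  proof (rule that)
    show "integrable ?\<rho> g" unfolding g_def using g1(1) g2(1) g3(1) g4(1) by auto
  next
    fix h :: "'b \<Rightarrow> complex" and C
    assume h[measurable]: "h \<in> borel_measurable N" and C: "\<And>y. cmod (h y) \<le> C"
    have I: "integrable ?\<rho> (\<lambda>y. of_real (u y) * h y)" if "integrable ?\<rho> u" for u :: "'b \<Rightarrow> real"
      using that C by (intro integrable_mult_bounded[where C=C]) auto
    have J: "integrable \<Omega> (\<lambda>\<omega>. of_real (u \<omega>) * h (S \<omega>))" if "integrable \<Omega> u" for u :: "'a \<Rightarrow> real"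
      using that C by (intro integrable_mult_bounded[where C=C]) auto
    note Is = I[OF g1(1)] I[OF g2(1)] I[OF g3(1)] I[OF g4(1)]
    note Js = J[OF int(1)] J[OF int(2)] J[OF int(3)] J[OF int(4)]
    note eqs = g1(2)[OF h] g2(2)[OF h] g3(2)[OF h] g4(2)[OF h]
    have "(\<integral>y. g y * h y \<partial>?\<rho>) =
        (\<integral>y. (of_real (g1 y) * h y - of_real (g2 y) * h y) +
              \<i> * (of_real (g3 y) * h y - of_real (g4 y) * h y) \<partial>?\<rho>)"
      unfolding g_def by (simp add: algebra_simps)
    also have "\<dots> = ((\<integral>y. of_real (g1 y) * h y \<partial>?\<rho>) - (\<integral>y. of_real (g2 y) * h y \<partial>?\<rho>)) +
              \<i> * ((\<integral>y. of_real (g3 y) * h y \<partial>?\<rho>) - (\<integral>y. of_real (g4 y) * h y \<partial>?\<rho>))"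
      using Is by simp
    also have "\<dots> = ((\<integral>\<omega>. of_real (F1 \<omega>) * h (S \<omega>) \<partial>\<Omega>) - (\<integral>\<omega>. of_real (F2 \<omega>) * h (S \<omega>) \<partial>\<Omega>)) +
              \<i> * ((\<integral>\<omega>. of_real (F3 \<omega>) * h (S \<omega>) \<partial>\<Omega>) - (\<integral>\<omega>. of_real (F4 \<omega>) * h (S \<omega>) \<partial>\<Omega>))"
      using eqs by (simp only: scaleR_conv_of_real)
    also have "\<dots> = (\<integral>\<omega>. (of_real (F1 \<omega>) * h (S \<omega>) - of_real (F2 \<omega>) * h (S \<omega>)) +
              \<i> * (of_real (F3 \<omega>) * h (S \<omega>) - of_real (F4 \<omega>) * h (S \<omega>)) \<partial>\<Omega>)"
      using Js by simp
    also have "\<dots> = (\<integral>\<omega>. F \<omega> * h (S \<omega>) \<partial>\<Omega>)"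
      by (rule Bochner_Integration.integral_cong[OF refl]) (subst F_eq, simp only: algebra_simps)
    finally show "(\<integral>y. g y * h y \<partial>?\<rho>) = (\<integral>\<omega>. F \<omega> * h (S \<omega>) \<partial>\<Omega>)" .
  qed
qed

text \<open>
  This is the $L^2$-contractivity of conditional expectation. It follows by testing \<open>g\<close> against its
  own conjugate; as \<open>g\<close> is not known to be square-integrable beforehand, the conjugate is cut off
  where \<open>|g| > n\<close>, and \<open>n\<close> tends to infinity by monotone convergence.
\<close>

lemma pushforward_density_L2_le:
  fixes F :: "'a \<Rightarrow> complex" and g :: "'b \<Rightarrow> complex"
  assumes fin: "finite_measure \<Omega>" and S[measurable]: "S \<in> measurable \<Omega> N"
    and F: "F \<in> L2_space \<Omega>"
    and g[measurable]: "g \<in> borel_measurable N"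
    and eq: "\<And>h C. h \<in> borel_measurable N \<Longrightarrow> (\<And>y. cmod (h y) \<le> C) \<Longrightarrow>
      (\<integral>y. g y * h y \<partial>distr \<Omega> N S) = (\<integral>\<omega>. F \<omega> * h (S \<omega>) \<partial>\<Omega>)"
  shows "L2_norm_sq (distr \<Omega> N S) g \<le> L2_norm_sq \<Omega> F"
proof -
  interpret finite_measure \<Omega> by (rule fin)
  let ?\<rho> = "distr \<Omega> N S"
  interpret \<rho>: finite_measure ?\<rho> by (rule finite_measure_distr) simp
  have [measurable]: "F \<in> borel_measurable \<Omega>" and F2: "integrable \<Omega> (\<lambda>\<omega>. (cmod (F \<omega>))\<^sup>2)"
    using F by (auto simp: L2_space_def)
  define h where "h n y = (if cmod (g y) \<le> real n then cnj (g y) else 0)" for n y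
  have h[measurable]: "h n \<in> borel_measurable N" for n
  proof -
    have [measurable]: "(\<lambda>y. cnj (g y)) \<in> borel_measurable N"
      using borel_measurable_continuous_on[of cnj, OF _ g] by (simp add: continuous_intros)
    show ?thesis unfolding h_def by measurable
  qed
  have hn: "cmod (h n y) \<le> n" for n y by (simp add: h_def)
  have gh: "g y * h n y = of_real ((cmod (h n y))\<^sup>2)" for n y
    by (simp add: h_def complex_norm_square[symmetric])
  have h2: "integrable ?\<rho> (\<lambda>y. (cmod (h n y))\<^sup>2)" for n
    using hn by (intro \<rho>.integrable_const_bound[where B="(real n)\<^sup>2"]) (auto intro!: power_mono)
  have F_int: "integrable \<Omega> F"
    using fin F by (rule L2_space_imp_integrable)
  have trunc: "(\<integral>y. (cmod (h n y))\<^sup>2 \<partial>?\<rho>) \<le> (\<integral>\<omega>. (cmod (F \<omega>))\<^sup>2 \<partial>\<Omega>)" for n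
  proof -
    define X where "X = (\<integral>y. (cmod (h n y))\<^sup>2 \<partial>?\<rho>)"
    have Fh: "integrable \<Omega> (\<lambda>\<omega>. F \<omega> * h n (S \<omega>))"
      using F_int hn by (intro integrable_mult_bounded[where C="real n"]) auto
    have hS: "integrable \<Omega> (\<lambda>\<omega>. (cmod (h n (S \<omega>)))\<^sup>2)"
      using h2[of n] by (simp add: integrable_distr_eq)
    have "complex_of_real X = (\<integral>y. g y * h n y \<partial>?\<rho>)"
      unfolding X_def gh by (rule integral_complex_of_real[symmetric])
    also have "\<dots> = (\<integral>\<omega>. F \<omega> * h n (S \<omega>) \<partial>\<Omega>)"
      using hn by (intro eq) auto
    finally have "X = Re (\<integral>\<omega>. F \<omega> * h n (S \<omega>) \<partial>\<Omega>)"
      by (metis Re_complex_of_real)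
    also have "\<dots> = (\<integral>\<omega>. Re (F \<omega> * h n (S \<omega>)) \<partial>\<Omega>)"
      using Fh by (rule integral_Re[symmetric])
    finally have X: "X = (\<integral>\<omega>. Re (F \<omega> * h n (S \<omega>)) \<partial>\<Omega>)" .
    \<comment> \<open>The bound on the right-hand side is \<open>\<parallel>F\<parallel>\<^sup>2 + X\<close>; as \<open>X\<close> is finite, it can be cancelled.\<close>
    have "2 * X = (\<integral>\<omega>. 2 * Re (F \<omega> * h n (S \<omega>)) \<partial>\<Omega>)"
      unfolding X by (simp del: times_complex.sel)
    also have "\<dots> \<le> (\<integral>\<omega>. (cmod (F \<omega>))\<^sup>2 + (cmod (h n (S \<omega>)))\<^sup>2 \<partial>\<Omega>)"
    proof (rule integral_mono)
      fix \<omega>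
      have "Re (F \<omega> * h n (S \<omega>)) \<le> cmod (F \<omega>) * cmod (h n (S \<omega>))"
        by (metis complex_Re_le_cmod norm_mult)
      moreover have "2 * (cmod (F \<omega>) * cmod (h n (S \<omega>))) \<le> (cmod (F \<omega>))\<^sup>2 + (cmod (h n (S \<omega>)))\<^sup>2"
        using sum_squares_bound[of "cmod (F \<omega>)" "cmod (h n (S \<omega>))"] by simp
      ultimately show "2 * Re (F \<omega> * h n (S \<omega>)) \<le> (cmod (F \<omega>))\<^sup>2 + (cmod (h n (S \<omega>)))\<^sup>2"
        by linarith
    qed (use F2 hS Fh in \<open>auto simp del: times_complex.sel\<close>)
    also have "\<dots> = (\<integral>\<omega>. (cmod (F \<omega>))\<^sup>2 \<partial>\<Omega>) + (\<integral>\<omega>. (cmod (h n (S \<omega>)))\<^sup>2 \<partial>\<Omega>)"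
      using F2 hS by simp
    also have "(\<integral>\<omega>. (cmod (h n (S \<omega>)))\<^sup>2 \<partial>\<Omega>) = X"
      unfolding X_def by (simp add: integral_distr)
    finally show ?thesis unfolding X_def by simp
  qed
  have sup: "ennreal ((cmod (g y))\<^sup>2) = (SUP n. ennreal ((cmod (h n y))\<^sup>2))" for y
  proof (rule antisym)
    obtain n where "cmod (g y) \<le> real n" using real_arch_simple by blast
    then have "(cmod (g y))\<^sup>2 = (cmod (h n y))\<^sup>2" by (simp add: h_def)
    then show "ennreal ((cmod (g y))\<^sup>2) \<le> (SUP n. ennreal ((cmod (h n y))\<^sup>2))"
      by (intro SUP_upper2[of n]) auto
    show "(SUP n. ennreal ((cmod (h n y))\<^sup>2)) \<le> ennreal ((cmod (g y))\<^sup>2)"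
      by (rule SUP_least) (auto simp: h_def)
  qed
  have "L2_norm_sq ?\<rho> g = (SUP n. \<integral>\<^sup>+y. ennreal ((cmod (h n y))\<^sup>2) \<partial>?\<rho>)"
    unfolding L2_norm_sq_def sup
  proof (rule nn_integral_monotone_convergence_SUP)
    show "incseq (\<lambda>n y. ennreal ((cmod (h n y))\<^sup>2))"
      by (auto simp: incseq_def le_fun_def h_def)
  qed simp
  also have "\<dots> \<le> ennreal (\<integral>\<omega>. (cmod (F \<omega>))\<^sup>2 \<partial>\<Omega>)"
    using trunc h2 by (intro SUP_least) (simp add: nn_integral_eq_integral)
  also have "\<dots> = L2_norm_sq \<Omega> F"
    unfolding L2_norm_sq_def using F2 by (simp add: nn_integral_eq_integral)
  finally show ?thesis .
qed


section \<open>The operator \<open>P\<close>\<close>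

context
  fixes \<mu> \<mu>' :: "(real ^ 'd) measure"
  assumes prob_\<mu>: "prob_space \<mu>" and sets_\<mu>[measurable_cong]: "sets \<mu> = sets borel"
    and prob_\<mu>': "prob_space \<mu>'" and sets_\<mu>'[measurable_cong]: "sets \<mu>' = sets borel"
begin

interpretation \<mu>: prob_space \<mu> by (rule prob_\<mu>)
interpretation \<mu>': prob_space \<mu>' by (rule prob_\<mu>')
interpretation pair_prob_space \<mu> \<mu>' ..

lemma convolution_eq_distr: "\<mu> \<star> \<mu>' = distr (\<mu> \<Otimes>\<^sub>M \<mu>') borel (\<lambda>\<omega>. fst \<omega> + snd \<omega>)"
  by (simp add: convolution_def case_prod_beta')

lemma integrable_pair_fst:
  fixes f :: "real ^ 'd \<Rightarrow> complex"
  assumes "integrable \<mu> f"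
  shows "integrable (\<mu> \<Otimes>\<^sub>M \<mu>') (\<lambda>\<omega>. f (fst \<omega>))"
proof -
  have [measurable]: "f \<in> borel_measurable \<mu>" using assms by simp
  have "integrable (\<mu> \<Otimes>\<^sub>M \<mu>') (\<lambda>(x, y). f x)"
    using assms by (intro Fubini_integrable) auto
  then show ?thesis by (simp add: case_prod_beta')
qed

lemma L2_norm_sq_pair_fst:
  assumes [measurable]: "f \<in> borel_measurable \<mu>"
  shows "L2_norm_sq (\<mu> \<Otimes>\<^sub>M \<mu>') (\<lambda>\<omega>. f (fst \<omega>)) = L2_norm_sq \<mu> f"
  unfolding L2_norm_sq_def by (subst \<mu>'.nn_integral_fst[symmetric]) (auto simp: \<mu>'.emeasure_space_1)

lemma complex_convolution_eq_pair_integral: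
  assumes f: "integrable \<mu> f" and E: "E \<in> sets borel"
  shows "complex_convolution (complex_density \<mu> f) \<mu>' E =
    (\<integral>\<omega>. f (fst \<omega>) * indicator E (fst \<omega> + snd \<omega>) \<partial>(\<mu> \<Otimes>\<^sub>M \<mu>'))"
proof -
  note [measurable] = E
  have "integrable (\<mu> \<Otimes>\<^sub>M \<mu>') (\<lambda>\<omega>. f (fst \<omega>) * indicator E (fst \<omega> + snd \<omega>))"
    by (intro integrable_mult_bounded[where C=1] integrable_pair_fst f) (auto simp: indicator_def)
  then have *: "integrable (\<mu> \<Otimes>\<^sub>M \<mu>') (\<lambda>(x, y). f x * indicator E (x + y))"
    by (simp add: case_prod_beta')
  have "complex_convolution (complex_density \<mu> f) \<mu>' E =
      (\<integral>y. \<integral>x. f x * indicator E (x + y) \<partial>\<mu> \<partial>\<mu>')"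
    unfolding complex_convolution_def complex_density_def set_lebesgue_integral_def
    by (intro Bochner_Integration.integral_cong refl) (auto simp: indicator_def)
  also have "\<dots> = (\<integral>\<omega>. f (fst \<omega>) * indicator E (fst \<omega> + snd \<omega>) \<partial>(\<mu> \<Otimes>\<^sub>M \<mu>'))"
    using integral_snd[OF *] by (simp add: case_prod_beta')
  finally show ?thesis .
qed

text \<open>
  The second identity is the characterisation of \<open>P f\<close> by bounded test functions. The definition of
  \<open>P f\<close> only gives it for indicator functions, but that determines \<open>P f\<close> almost everywhere, and the
  push-forward density satisfies it for all bounded \<open>h\<close>. The existence of that density also ensures
  that the choice in the definition of \<open>P f\<close> is made among actual derivatives.
\<close>

lemma
  assumes f: "integrable \<mu> f"
  shows integrable_P_op: "integrable (\<mu> \<star> \<mu>') (P_op \<mu> \<mu>' f)"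
    and integral_P_op_mult: "\<And>h C. h \<in> borel_measurable borel \<Longrightarrow> (\<And>z. cmod (h z) \<le> C) \<Longrightarrow>
      (\<integral>z. P_op \<mu> \<mu>' f z * h z \<partial>(\<mu> \<star> \<mu>')) =
      (\<integral>\<omega>. f (fst \<omega>) * h (fst \<omega> + snd \<omega>) \<partial>(\<mu> \<Otimes>\<^sub>M \<mu>'))"
proof -
  let ?\<rho> = "\<mu> \<star> \<mu>'" and ?\<kappa> = "complex_convolution (complex_density \<mu> f) \<mu>'"
  interpret \<rho>: finite_measure ?\<rho>
    using convolution_finite \<mu>.finite_measure_axioms \<mu>'.finite_measure_axioms sets_\<mu> sets_\<mu>' by blast
  have S: "(\<lambda>\<omega>. fst \<omega> + snd \<omega>) \<in> borel_measurable (\<mu> \<Otimes>\<^sub>M \<mu>')" by measurable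
  obtain g where g: "integrable ?\<rho> g"
    and g_test: "\<And>h C. h \<in> borel_measurable borel \<Longrightarrow> (\<And>z. cmod (h z) \<le> C) \<Longrightarrow>
      (\<integral>z. g z * h z \<partial>?\<rho>) = (\<integral>\<omega>. f (fst \<omega>) * h (fst \<omega> + snd \<omega>) \<partial>(\<mu> \<Otimes>\<^sub>M \<mu>'))"
    using pushforward_density[OF P.finite_measure_axioms S integrable_pair_fst[OF f]]
    unfolding convolution_eq_distr[symmetric] by blast
  have g_RN: "is_complex_RN_deriv ?\<rho> ?\<kappa> g"
    unfolding is_complex_RN_deriv_def
  proof (intro conjI ballI)
    fix E assume "E \<in> sets ?\<rho>"
    then have E: "E \<in> sets borel" by simp
    have "?\<kappa> E = (\<integral>z. g z * indicator E z \<partial>?\<rho>)"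
      unfolding complex_convolution_eq_pair_integral[OF f E]
      using E by (intro g_test[symmetric, of "indicator E" 1]) (auto simp: indicator_def)
    also have "\<dots> = (LINT z:E|?\<rho>. g z)"
      unfolding set_lebesgue_integral_def
      by (intro Bochner_Integration.integral_cong refl) (auto simp: indicator_def)
    finally show "?\<kappa> E = (LINT z:E|?\<rho>. g z)" .
  qed (rule g)
  then have P_RN: "is_complex_RN_deriv ?\<rho> ?\<kappa> (P_op \<mu> \<mu>' f)"
    unfolding P_op_def by (rule someI[of "is_complex_RN_deriv ?\<rho> ?\<kappa>"])
  then show int: "integrable ?\<rho> (P_op \<mu> \<mu>' f)"
    by (simp add: is_complex_RN_deriv_def)
  have AE_eq: "AE z in ?\<rho>. P_op \<mu> \<mu>' f z = g z"
    by (rule \<rho>.density_unique_banach[OF int g])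
      (use P_RN g_RN in \<open>simp add: is_complex_RN_deriv_def\<close>)
  fix h :: "real ^ 'd \<Rightarrow> complex" and C
  assume h: "h \<in> borel_measurable borel" "\<And>z. cmod (h z) \<le> C"
  have "(\<integral>z. P_op \<mu> \<mu>' f z * h z \<partial>?\<rho>) = (\<integral>z. g z * h z \<partial>?\<rho>)"
    using AE_eq int[THEN borel_measurable_integrable] g[THEN borel_measurable_integrable] h(1)
    by (intro integral_cong_AE) auto
  then show "(\<integral>z. P_op \<mu> \<mu>' f z * h z \<partial>?\<rho>) =
      (\<integral>\<omega>. f (fst \<omega>) * h (fst \<omega> + snd \<omega>) \<partial>(\<mu> \<Otimes>\<^sub>M \<mu>'))"
    using g_test[OF h] by simp
qed

lemma L2_norm_sq_P_op_le:
  assumes f: "f \<in> L2_space \<mu>"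
  shows "L2_norm_sq (\<mu> \<star> \<mu>') (P_op \<mu> \<mu>' f) \<le> L2_norm_sq \<mu> f"
proof -
  have int: "integrable \<mu> f"
    using \<mu>.finite_measure_axioms f by (rule L2_space_imp_integrable)
  have [measurable]: "f \<in> borel_measurable \<mu>" using int by simp
  (* |f|^2 is passed through complex numbers because integrable_pair_fst is about complex functions *)
  have "integrable \<mu> (\<lambda>x. complex_of_real ((cmod (f x))\<^sup>2))"
    using f by (auto simp: L2_space_def simp del: of_real_power)
  from integrable_Re[OF integrable_pair_fst[OF this]]
  have F: "(\<lambda>\<omega>. f (fst \<omega>)) \<in> L2_space (\<mu> \<Otimes>\<^sub>M \<mu>')"
    by (simp add: L2_space_def del: of_real_power)
  have S: "(\<lambda>\<omega>. fst \<omega> + snd \<omega>) \<in> borel_measurable (\<mu> \<Otimes>\<^sub>M \<mu>')" by measurable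
  have P: "P_op \<mu> \<mu>' f \<in> borel_measurable borel"
    using integrable_P_op[OF int, THEN borel_measurable_integrable] by simp
  have "L2_norm_sq (\<mu> \<star> \<mu>') (P_op \<mu> \<mu>' f) \<le> L2_norm_sq (\<mu> \<Otimes>\<^sub>M \<mu>') (\<lambda>\<omega>. f (fst \<omega>))"
    unfolding convolution_eq_distr
    by (rule pushforward_density_L2_le[OF P.finite_measure_axioms S F P])
      (rule integral_P_op_mult[OF int, unfolded convolution_eq_distr])
  then show ?thesis by (simp add: L2_norm_sq_pair_fst)
qed

lemma P_op_in_L2_space:
  assumes f: "f \<in> L2_space \<mu>"
  shows "P_op \<mu> \<mu>' f \<in> L2_space (\<mu> \<star> \<mu>')"
proof -
  have int: "integrable \<mu> f"
    using \<mu>.finite_measure_axioms f by (rule L2_space_imp_integrable)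
  have P: "P_op \<mu> \<mu>' f \<in> borel_measurable (\<mu> \<star> \<mu>')"
    using integrable_P_op[OF int] by (rule borel_measurable_integrable)
  have "L2_norm_sq \<mu> f < \<infinity>"
    using f by (simp add: L2_space_def L2_norm_sq_def integrable_iff_bounded)
  then have "L2_norm_sq (\<mu> \<star> \<mu>') (P_op \<mu> \<mu>' f) < \<infinity>"
    using L2_norm_sq_P_op_le[OF f] by (rule le_less_trans[rotated])
  then show ?thesis
    using P by (simp add: L2_space_def L2_norm_sq_def integrable_iff_bounded)
qed

section \<open>Fourier transforms\<close>

text \<open>
  The convolution theorem for \<open>(f d\<mu>) \<star> \<mu>' = (P f) d(\<mu> \<star> \<mu>')\<close>: the character \<open>e\<close> turns the sum
  \<open>x + y\<close> into a product, and Fubini separates the two variables.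
\<close>

lemma fourier_P_op:
  assumes f: "integrable \<mu> f"
  shows "fourier_fun_measure (\<mu> \<star> \<mu>') (P_op \<mu> \<mu>' f) t =
    fourier_fun_measure \<mu> f t * fourier_measure \<mu>' t"
proof -
  define e where "e x = exp (- 2 * of_real pi * \<i> * of_real (t \<bullet> x))" for x
  have [measurable]: "e \<in> borel_measurable borel"
    unfolding e_def by (intro borel_measurable_continuous_onI continuous_intros)
  have e_norm: "cmod (e x) \<le> 1" for x by (simp add: e_def)
  have e_add: "e (x + y) = e x * e y" for x y
    by (simp add: e_def inner_add_right exp_add[symmetric] algebra_simps)
  have fe: "integrable \<mu> (\<lambda>x. f x * e x)"
    using f e_norm by (intro integrable_mult_bounded[where C=1]) auto
  have "integrable (\<mu> \<Otimes>\<^sub>M \<mu>') (\<lambda>\<omega>. (f (fst \<omega>) * e (fst \<omega>)) * e (snd \<omega>))"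
    using e_norm by (intro integrable_mult_bounded[where C=1] integrable_pair_fst[OF fe]) auto
  then have int: "integrable (\<mu> \<Otimes>\<^sub>M \<mu>') (\<lambda>(x, y). f x * e x * e y)"
    by (simp add: case_prod_beta')
  have "(\<integral>z. P_op \<mu> \<mu>' f z * e z \<partial>(\<mu> \<star> \<mu>')) =
      (\<integral>\<omega>. f (fst \<omega>) * e (fst \<omega> + snd \<omega>) \<partial>(\<mu> \<Otimes>\<^sub>M \<mu>'))"
    using e_norm by (intro integral_P_op_mult[OF f]) auto
  also have "\<dots> = (\<integral>x. \<integral>y. f x * e x * e y \<partial>\<mu>' \<partial>\<mu>)"
    using integral_fst[OF int] by (simp add: e_add case_prod_beta' mult.assoc)
  also have "\<dots> = (\<integral>x. f x * e x \<partial>\<mu>) * (\<integral>y. e y \<partial>\<mu>')"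
    by simp
  finally show ?thesis
    unfolding fourier_fun_measure_def fourier_measure_def e_def .
qed

lemma measurable_fourier_measure: "fourier_measure \<mu>' \<in> borel_measurable borel"
proof -
  have "(\<lambda>(t, x). exp (- 2 * of_real pi * \<i> * of_real (t \<bullet> x))) \<in> borel_measurable (borel \<Otimes>\<^sub>M \<mu>')"
    by measurable
  then show ?thesis
    unfolding fourier_measure_def[abs_def] by (intro \<mu>'.borel_measurable_lebesgue_integral)
qed

lemma measurable_fourier_fun_measure:
  assumes [measurable]: "f \<in> borel_measurable \<mu>"
  shows "fourier_fun_measure \<mu> f \<in> borel_measurable borel"
proof -
  have "(\<lambda>(t, x). f x * exp (- 2 * of_real pi * \<i> * of_real (t \<bullet> x))) \<in> borel_measurable (borel \<Otimes>\<^sub>M \<mu>)"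
    by measurable
  then show ?thesis
    unfolding fourier_fun_measure_def[abs_def] by (intro \<mu>.borel_measurable_lebesgue_integral)
qed

text \<open>
  The weight is exactly the factor by which the transforms of \<open>f d\<mu>\<close> and \<open>(P f) d(\<mu> \<star> \<mu>')\<close>
  differ in squared modulus.
\<close>

lemma L2_norm_sq_weighted_fourier:
  assumes f: "integrable \<mu> f" and \<nu>[measurable_cong]: "sets \<nu> = sets borel"
  shows "L2_norm_sq (density \<nu> (\<lambda>t. ennreal ((cmod (fourier_measure \<mu>' t))\<^sup>2))) (fourier_fun_measure \<mu> f)
    = L2_norm_sq \<nu> (fourier_fun_measure (\<mu> \<star> \<mu>') (P_op \<mu> \<mu>' f))"
proof -
  note [measurable] = measurable_fourier_measure
    measurable_fourier_fun_measure[OF borel_measurable_integrable[OF f]]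
  show ?thesis
    unfolding L2_norm_sq_def
    by (subst nn_integral_density)
      (auto simp: fourier_P_op[OF f] norm_mult power_mult_distrib ennreal_mult mult.commute intro!: nn_integral_cong)
qed

end

section \<open>Transfer of Bessel and frame bounds\<close>

theorem proposition2p9:
  fixes \<mu> \<mu>' \<nu> :: "(real ^ 'd) measure" and B :: real
  assumes "prob_space \<mu>" and "sets \<mu> = sets borel"
    and "prob_space \<mu>'" and "sets \<mu>' = sets borel"
    and "bessel_measure (\<mu> \<star> \<mu>') \<nu> B"
  shows "bessel_measure \<mu> (density \<nu> (\<lambda>t. ennreal ((cmod (fourier_measure \<mu>' t))\<^sup>2))) B \<and>
    (\<forall>A B' c :: real.
       frame_measure (\<mu> \<star> \<mu>') \<nu> A B' \<and> 0 < c \<and>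
       (\<forall>f \<in> L2_space \<mu>.
          ennreal c * L2_norm_sq \<mu> f \<le> L2_norm_sq (\<mu> \<star> \<mu>') (P_op \<mu> \<mu>' f)) \<longrightarrow>
       frame_measure \<mu> (density \<nu> (\<lambda>t. ennreal ((cmod (fourier_measure \<mu>' t))\<^sup>2))) (c * A) B')"
proof -
  note conv = assms(1-4)
  let ?\<nu>' = "density \<nu> (\<lambda>t. ennreal ((cmod (fourier_measure \<mu>' t))\<^sup>2))"
  let ?P = "P_op \<mu> \<mu>'" and ?\<F> = "fourier_fun_measure (\<mu> \<star> \<mu>')"
  have \<nu>: "sets \<nu> = sets borel" using assms(5) by (simp add: bessel_measure_def)
  have P: "?P f \<in> L2_space (\<mu> \<star> \<mu>')" if "f \<in> L2_space \<mu>" for f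
    using P_op_in_L2_space[OF conv that] .
  have transfer: "L2_norm_sq ?\<nu>' (fourier_fun_measure \<mu> f) = L2_norm_sq \<nu> (?\<F> (?P f))"
    if "f \<in> L2_space \<mu>" for f
    using L2_norm_sq_weighted_fourier[OF conv L2_space_imp_integrable[OF _ that] \<nu>]
      prob_space.finite_measure[OF assms(1)] by simp
  have upper: "L2_norm_sq ?\<nu>' (fourier_fun_measure \<mu> f) \<le> ennreal b * L2_norm_sq \<mu> f"
    if f: "f \<in> L2_space \<mu>"
      and bound: "\<forall>g \<in> L2_space (\<mu> \<star> \<mu>'). L2_norm_sq \<nu> (?\<F> g) \<le> ennreal b * L2_norm_sq (\<mu> \<star> \<mu>') g" for f b
  proof -
    have "L2_norm_sq \<nu> (?\<F> (?P f)) \<le> ennreal b * L2_norm_sq (\<mu> \<star> \<mu>') (?P f)"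
      using bound P[OF f] by blast
    also have "\<dots> \<le> ennreal b * L2_norm_sq \<mu> f"
      by (intro mult_left_mono L2_norm_sq_P_op_le[OF conv f]) simp
    finally show ?thesis by (simp add: transfer[OF f])
  qed
  have "bessel_measure \<mu> ?\<nu>' B"
    using assms(5) upper \<nu> by (simp add: bessel_measure_def)
  moreover have "frame_measure \<mu> ?\<nu>' (c * A) B'"
    if fr: "frame_measure (\<mu> \<star> \<mu>') \<nu> A B'" and c: "0 < c"
      and lower_P: "\<forall>f \<in> L2_space \<mu>. ennreal c * L2_norm_sq \<mu> f \<le> L2_norm_sq (\<mu> \<star> \<mu>') (?P f)" for A B' c
  proof -
    have A: "0 < A" and B': "0 < B'" using fr by (auto simp: frame_measure_def)
    have "ennreal (c * A) * L2_norm_sq \<mu> f \<le> L2_norm_sq ?\<nu>' (fourier_fun_measure \<mu> f)"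
      if f: "f \<in> L2_space \<mu>" for f
    proof -
      have "ennreal (c * A) * L2_norm_sq \<mu> f = ennreal A * (ennreal c * L2_norm_sq \<mu> f)"
        using A c by (simp add: ennreal_mult ac_simps)
      also have "\<dots> \<le> ennreal A * L2_norm_sq (\<mu> \<star> \<mu>') (?P f)"
        using lower_P f by (intro mult_left_mono) auto
      also have "\<dots> \<le> L2_norm_sq \<nu> (?\<F> (?P f))"
        using fr P[OF f] by (auto simp: frame_measure_def)
      finally show ?thesis by (simp add: transfer[OF f])
    qed
    moreover have "\<forall>g \<in> L2_space (\<mu> \<star> \<mu>'). L2_norm_sq \<nu> (?\<F> g) \<le> ennreal B' * L2_norm_sq (\<mu> \<star> \<mu>') g"
      using fr by (simp add: frame_measure_def)
    ultimately show ?thesis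
      using A B' c \<nu> upper by (simp add: frame_measure_def)
  qed
  ultimately show ?thesis
    by (intro conjI allI impI) (assumption, elim conjE)
qed

end
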